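(* Fix $\eta\in(0,1/2)$. For all integers $N\ge1$, all odd primes $p$ and all $\alpha\in\mathscr B(p,N)$, \[ \frac1{\#\mathcal V(p,N)}\#\Big\{x\in\mathcal V(p,N):\ \mathfrak d_{p,N}(\alpha,x)\in\Big[\sqrt{A_{p,N}(\alpha,\mathcal V)}-p^{-\eta},\ \sqrt{A_{p,N}(\alpha,\mathcal V)}+p^{-\eta}\Big]\Big\}\ \ge\ 1-\frac{22}{p^{1-2\eta}}, \] where $A_{p,N}(\alpha,\mathcal V)=\frac1{\#\mathcal V(p,N)}\sum_{x\in\mathcal V(p,N)}\mathfrak d_{p,N}(\alpha,x)^2$.
   Context: $\omega=\exp(2\pi i/p)$; $\mathscr B(p,N)=\{\sum_{j=1}^{p-1}a_j\omega^j: a_j\in[-N,N]\cap\mathbb{Z}\}$, $\mathcal V(p,N)=\{\sum_{j=1}^{p-1}a_j\omega^j: a_j\in\{-N,N\}\}$. For $\gamma\in\mathbb{Q}(\omega)$, $\mathrm{Tr}(\gamma)=\sum_{\sigma\in\mathrm{Gal}(\mathbb{Q}(\omega)/\mathbb{Q})}\sigma(\gamma)$, $\|\gamma\|=\big(\sum_{j=1}^{p-1}\mathrm{Tr}(\gamma\omega^j)^2\big)^{1/2}$, $\mathfrak d_{p,N}(\alpha,\beta)=\|\beta-\alpha\|/(2Np(p-1)^{1/2})$. *)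

theory Defs
  imports "HOL-Algebra.Generated_Fields" "HOL-Algebra.Algebraic_Closure_Type"
begin

abbreviation complex_ring :: "complex ring" where
  "complex_ring \<equiv> ring_of_type_algebra"

definition zeta :: "nat \<Rightarrow> complex" where
  "zeta p = exp (2 * of_real pi * \<i> / of_nat p)"

definition cyclotomic_field :: "nat \<Rightarrow> complex set" where
  "cyclotomic_field p = generate_field complex_ring (\<rat> \<union> {zeta p})"

text \<open>
  HOL functions are total, so field automorphisms are normalised to be \<^const>\<open>extensional\<close>;
  otherwise one automorphism would be represented by many functions.
\<close>
definition galois_group :: "nat \<Rightarrow> (complex \<Rightarrow> complex) set" where
  "galois_group p =
    (let K = complex_ring\<lparr>carrier := cyclotomic_field p\<rparr> in
     {\<sigma> \<in> ring_iso K K \<inter> extensional (cyclotomic_field p). \<forall>q\<in>\<rat>. \<sigma> q = q})"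

definition cyc_trace :: "nat \<Rightarrow> complex \<Rightarrow> complex" where
  "cyc_trace p \<gamma> = (\<Sum>\<sigma>\<in>galois_group p. \<sigma> \<gamma>)"

text \<open>
  Traces of elements of the cyclotomic field are real (lemma \<open>cyc_trace_real\<close> below), so
  \<^const>\<open>Re\<close> only changes the type of the sum.
\<close>
definition cyc_norm :: "nat \<Rightarrow> complex \<Rightarrow> real" where
  "cyc_norm p \<gamma> = sqrt (Re (\<Sum>j=1..p-1. (cyc_trace p (\<gamma> * zeta p ^ j))\<^sup>2))"

definition cyc_box :: "nat \<Rightarrow> int \<Rightarrow> complex set" where
  "cyc_box p N = {\<Sum>j=1..p-1. of_int (a j) * zeta p ^ j | a. \<forall>j\<in>{1..p-1}. a j \<in> {-N..N}}"

definition cyc_vertices :: "nat \<Rightarrow> int \<Rightarrow> complex set" where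
  "cyc_vertices p N = {\<Sum>j=1..p-1. of_int (a j) * zeta p ^ j | a. \<forall>j\<in>{1..p-1}. a j \<in> {-N, N}}"

definition cyc_dist :: "nat \<Rightarrow> int \<Rightarrow> complex \<Rightarrow> complex \<Rightarrow> real" where
  "cyc_dist p N \<alpha> \<beta> = cyc_norm p (\<beta> - \<alpha>) / (2 * of_int N * real p * sqrt (real (p - 1)))"

definition mean_sq_dist :: "nat \<Rightarrow> int \<Rightarrow> complex \<Rightarrow> complex set \<Rightarrow> real" where
  "mean_sq_dist p N \<alpha> S = (1 / real (card S)) * (\<Sum>x\<in>S. (cyc_dist p N \<alpha> x)\<^sup>2)"

lemma complex_ring_simps [simp]:
  "carrier complex_ring = UNIV" "x \<otimes>\<^bsub>complex_ring\<^esub> y = x * y" "x \<oplus>\<^bsub>complex_ring\<^esub> y = x + y"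
  "\<one>\<^bsub>complex_ring\<^esub> = 1" "\<zero>\<^bsub>complex_ring\<^esub> = 0"
  by (simp_all add: ring_of_type_algebra_def)

lemma complex_ring_inverse:
  assumes "x \<noteq> 0" shows "inv\<^bsub>complex_ring\<^esub> x = inverse x"
proof -
  interpret field complex_ring by (rule field_from_type_algebra)
  show ?thesis by (rule comm_inv_char) (use assms in auto)
qed

lemma complex_ring_uminus: "\<ominus>\<^bsub>complex_ring\<^esub> x = - x"
proof -
  interpret field complex_ring by (rule field_from_type_algebra)
  show ?thesis by (rule minus_equality) auto
qed

lemma cnj_zeta: "cnj (zeta p) = inverse (zeta p)"
proof -
  have "zeta p = cis (2 * pi / p)"
    by (simp add: zeta_def cis_conv_exp mult_ac)
  then show ?thesis by (simp add: cis_cnj cis_inverse)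
qed

lemma cnj_Rats: "q \<in> \<rat> \<Longrightarrow> cnj q = q"
  by (erule Rats_cases') simp

lemma cnj_cyclotomic_field:
  assumes "x \<in> cyclotomic_field p" shows "cnj x \<in> cyclotomic_field p"
  using assms unfolding cyclotomic_field_def
proof (induction rule: generate_field.induct)
  case one
  show ?case using generate_field.one[of complex_ring] by simp
next
  case (incl h)
  have "zeta p \<noteq> 0" by (simp add: zeta_def)
  then have "inverse (zeta p) \<in> generate_field complex_ring (\<rat> \<union> {zeta p})"
    using generate_field.m_inv[OF generate_field.incl, of "zeta p" "\<rat> \<union> {zeta p}" complex_ring]
    by (simp add: complex_ring_inverse)
  with incl show ?case
    by (auto simp: cnj_zeta cnj_Rats intro: generate_field.incl)
next
  case (a_inv h)
  from generate_field.a_inv[OF a_inv.IH] show ?case by (simp add: complex_ring_uminus)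
next
  case (m_inv h)
  then have "cnj h \<noteq> \<zero>\<^bsub>complex_ring\<^esub>" "h \<noteq> 0" by simp_all
  with generate_field.m_inv[OF m_inv.IH] show ?case by (simp add: complex_ring_inverse)
next
  case (eng_add h1 h2)
  from generate_field.eng_add[OF eng_add.IH] show ?case by simp
next
  case (eng_mult h1 h2)
  from generate_field.eng_mult[OF eng_mult.IH] show ?case by simp
qed

lemma cnj_galois_group:
  assumes "\<sigma> \<in> galois_group p"
  shows "restrict (cnj \<circ> \<sigma>) (cyclotomic_field p) \<in> galois_group p"
proof -
  let ?K = "cyclotomic_field p"
  have bij: "bij_betw cnj ?K ?K"
    by (rule bij_betw_byWitness[where f' = cnj]) (auto intro: cnj_cyclotomic_field)
  have \<sigma>: "bij_betw \<sigma> ?K ?K"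
    using assms by (simp add: galois_group_def Let_def ring_iso_def)
  have cl: "q \<in> ?K" if "q \<in> \<rat>" for q
    using that by (simp add: cyclotomic_field_def generate_field.incl)
  have cl_add: "x + y \<in> ?K" "x * y \<in> ?K" if "x \<in> ?K" "y \<in> ?K" for x y
    using that generate_field.eng_add[of x complex_ring] generate_field.eng_mult[of x complex_ring]
    by (auto simp: cyclotomic_field_def)
  have "bij_betw (restrict (cnj \<circ> \<sigma>) ?K) ?K ?K"
    using bij_betw_trans[OF \<sigma> bij] by (rule bij_betw_cong[THEN iffD1, rotated]) simp
  then show ?thesis
    using assms bij_betwE[OF bij] cl cl_add
    by (auto simp: galois_group_def Let_def ring_iso_def ring_hom_def Pi_iff cnj_Rats)
qed

lemma cyc_trace_real:
  assumes "\<gamma> \<in> cyclotomic_field p" shows "cyc_trace p \<gamma> \<in> \<real>"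
proof -
  let ?c = "\<lambda>\<sigma>. restrict (cnj \<circ> \<sigma>) (cyclotomic_field p)"
  have "?c (?c \<sigma>) = \<sigma>" if "\<sigma> \<in> galois_group p" for \<sigma>
    using that by (auto simp: galois_group_def Let_def extensional_def restrict_def fun_eq_iff)
  then have "(\<Sum>\<sigma>\<in>galois_group p. cnj (\<sigma> \<gamma>)) = (\<Sum>\<sigma>\<in>galois_group p. \<sigma> \<gamma>)"
    by (intro sum.reindex_bij_witness[where i = ?c and j = ?c])
       (use assms in \<open>auto intro: cnj_galois_group\<close>)
  then show ?thesis
    by (simp add: cyc_trace_def Reals_cnj_iff)
qed

end

theory Submission
  imports Defs "HOL-Number_Theory.Cong"
begin

text \<open>
  For \<open>\<gamma> = \<Sum>\<^sub>j c\<^sub>j \<omega>\<^sup>j\<close> with \<open>S = \<Sum>\<^sub>j c\<^sub>j\<close> one has \<open>Tr(\<gamma> \<omega>\<^sup>l) = p c\<^sub>p\<^sub>-\<^sub>l - S\<close>, and hence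
  \<open>\<parallel>\<gamma>\<parallel>\<^sup>2 = p\<^sup>2 \<Sum>\<^sub>j c\<^sub>j\<^sup>2 - (p + 1) S\<^sup>2\<close>. For a vertex with coefficients \<open>b\<^sub>j = \<plusminus>N\<close> the squared distance to \<open>\<alpha>\<close>
  is therefore its mean \<open>m\<close> plus a centred quadratic polynomial in independent signs. The variance of the latter is
  at most \<open>1 / (2p)\<close>, and \<open>m \<ge> 1 / 8\<close>. Since \<open>\<bar>d - \<surd>m\<bar> \<surd>m \<le> \<bar>d\<^sup>2 - m\<bar>\<close>, Chebyshev's inequality
  bounds the exceptional proportion by \<open>4 / p\<^sup>1\<^sup>-\<^sup>2\<^sup>\<eta>\<close>.

  The trace formula needs the full Galois group \<open>\<omega> \<mapsto> \<omega>\<^sup>k\<close>, that is, the linear independence of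
  \<open>1, \<omega>, \<dots>, \<omega>\<^sup>p\<^sup>-\<^sup>2\<close> over the rationals. This is shown by an Eisenstein argument in \<open>\<omega> - 1\<close>, based on the fact that
  an integer polynomial vanishing at \<open>\<omega>\<close> takes a value divisible by \<open>p\<close> at 1.
\<close>

subsection \<open>Integer polynomials at complex numbers\<close>

text \<open>Integer rather than rational coefficients keep content and divisibility by
  \<open>p\<close> meaningful; elements of the field are written as
  \<open>ieval f \<zeta> / of_int n\<close>.\<close>

definition ieval :: "int poly \<Rightarrow> complex \<Rightarrow> complex" where
  "ieval f z = poly (map_poly of_int f) z"

lemma ieval_0 [simp]: "ieval 0 z = 0"
  by (simp add: ieval_def)

lemma ieval_pCons [simp]: "ieval (pCons a f) z = of_int a + z * ieval f z"
  by (simp add: ieval_def map_poly_pCons)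

lemma ieval_1 [simp]: "ieval 1 z = 1"
  by (simp add: ieval_def)

lemma ieval_add [simp]: "ieval (f + g) z = ieval f z + ieval g z"
  by (induction f g rule: poly_induct2) (simp_all add: algebra_simps)

lemma ieval_uminus [simp]: "ieval (- f) z = - ieval f z"
  by (induction f) (simp_all add: algebra_simps)

lemma ieval_diff [simp]: "ieval (f - g) z = ieval f z - ieval g z"
  using ieval_add[of f "- g" z] by simp

lemma ieval_smult [simp]: "ieval (smult a f) z = of_int a * ieval f z"
  by (induction f) (simp_all add: algebra_simps)

lemma ieval_mult [simp]: "ieval (f * g) z = ieval f z * ieval g z"
  by (induction f) (simp_all add: algebra_simps)

lemma ieval_monom [simp]: "ieval (Polynomial.monom a n) z = of_int a * z ^ n"
  by (simp add: ieval_def map_poly_monom poly_monom)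

lemma ieval_sum [simp]: "ieval (sum f A) z = (\<Sum>x\<in>A. ieval (f x) z)"
  by (induction A rule: infinite_finite_induct) simp_all

lemma ieval_prod [simp]: "ieval (prod f A) z = (\<Prod>x\<in>A. ieval (f x) z)"
  by (induction A rule: infinite_finite_induct) simp_all

lemma ieval_pcompose [simp]: "ieval (pcompose f g) z = ieval f (ieval g z)"
  by (induction f) (simp_all add: pcompose_pCons)

lemma ieval_of_int: "ieval f (of_int m) = of_int (poly f m)"
  by (induction f) simp_all

lemma ieval_altdef: "ieval f z = (\<Sum>i\<le>Polynomial.degree f. of_int (poly.coeff f i) * z ^ i)"
  by (simp add: ieval_def poly_altdef degree_map_poly coeff_map_poly)

subsection \<open>Roots of unity of prime order\<close>

locale prime_cyclotomic =
  fixes p :: nat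
  assumes prime_p: "prime p"
begin

abbreviation \<zeta> :: complex where "\<zeta> \<equiv> zeta p"

lemma p_gt_1: "p > 1"
  using prime_p by (rule prime_gt_1_nat)

lemma zeta_power: "\<zeta> ^ k = cis (2 * pi * k / p)"
  by (simp add: zeta_def cis_conv_exp exp_of_nat_mult [symmetric] mult_ac)

lemma zeta_power_p [simp]: "\<zeta> ^ p = 1"
  using p_gt_1 by (simp add: zeta_power)

lemma zeta_power_mod: "\<zeta> ^ (k mod p) = \<zeta> ^ k"
proof -
  have "\<zeta> ^ k = \<zeta> ^ (p * (k div p) + k mod p)" by simp
  also have "\<dots> = \<zeta> ^ (k mod p)" by (simp only: power_add power_mult zeta_power_p) simp
  finally show ?thesis ..
qed

lemma zeta_power_inj: "inj_on (\<lambda>k. \<zeta> ^ k) {..<p}"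
  using bij_betw_roots_unity[of p] p_gt_1 by (auto simp: zeta_power bij_betw_def mult_ac)

lemma root_of_unityE:
  assumes "z ^ p = 1" obtains k where "k < p" "z = \<zeta> ^ k"
  using bij_betw_roots_unity[of p] p_gt_1 assms
  by (auto simp: zeta_power bij_betw_def image_iff set_eq_iff mult_ac)

lemma zeta_power_eq_1_iff: "\<zeta> ^ k = 1 \<longleftrightarrow> p dvd k"
proof -
  have "\<zeta> ^ (k mod p) = \<zeta> ^ 0 \<longleftrightarrow> k mod p = 0"
    using p_gt_1 by (intro inj_on_eq_iff[OF zeta_power_inj]) auto
  then show ?thesis by (simp add: zeta_power_mod dvd_eq_mod_eq_0)
qed

lemma sum_zeta_power: "(\<Sum>k<p. \<zeta> ^ (k * i)) = (if p dvd i then of_nat p else 0)"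
proof (cases "p dvd i")
  case True
  then have "\<zeta> ^ (k * i) = 1" for k by (simp add: zeta_power_eq_1_iff)
  with True show ?thesis by simp
next
  case False
  then have ne: "\<zeta> ^ i \<noteq> 1" by (simp add: zeta_power_eq_1_iff)
  have "(\<Sum>k<p. \<zeta> ^ (k * i)) = (\<Sum>k<p. (\<zeta> ^ i) ^ k)"
    by (simp only: power_mult [symmetric] mult.commute)
  also have "\<dots> = ((\<zeta> ^ i) ^ p - 1) / (\<zeta> ^ i - 1)"
    using ne by (rule geometric_sum)
  also have "(\<zeta> ^ i) ^ p = 1"
    by (metis power_mult mult.commute zeta_power_p power_one)
  finally show ?thesis using False by simp
qed

lemma sum_nontrivial_zeta_power:
  "(\<Sum>k=1..p-1. \<zeta> ^ (k * i)) = (if p dvd i then of_nat p else 0) - 1"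
proof -
  have "{..<p} = insert 0 {1..p-1}" using p_gt_1 by auto
  then have "(\<Sum>k<p. \<zeta> ^ (k * i)) = 1 + (\<Sum>k=1..p-1. \<zeta> ^ (k * i))" by simp
  then show ?thesis unfolding sum_zeta_power by (simp add: algebra_simps)
qed

text \<open>Primality makes \<open>l\<close> invertible modulo \<open>p\<close>, so multiplication
  by \<open>l\<close> is injective on the nonzero residues, and a finite set has no proper injective
  image in itself. This permutes the conjugates of \<open>\<zeta>\<close>.\<close>

lemma bij_betw_mult_mod:
  assumes "l \<in> {1..p-1}"
  shows "bij_betw (\<lambda>k. k * l mod p) {1..p-1} {1..p-1}"
proof -
  have cop: "coprime l p"
    using assms prime_p p_gt_1
    by (subst coprime_commute) (auto intro!: prime_imp_coprime dest: dvd_imp_le)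
  have inj: "inj_on (\<lambda>k. k * l mod p) {1..p-1}"
  proof (rule inj_onI)
    fix x y assume xy: "x \<in> {1..p-1}" "y \<in> {1..p-1}" "x * l mod p = y * l mod p"
    have "[x * l = y * l] (mod p)" using xy by (simp add: unique_euclidean_semiring_class.cong_def)
    then have "[x = y] (mod p)" using cop cong_mult_rcancel_nat by blast
    then show "x = y" using xy p_gt_1 by (auto simp: unique_euclidean_semiring_class.cong_def)
  qed
  have "k * l mod p \<in> {1..p-1}" if "k \<in> {1..p-1}" for k
  proof -
    have "\<not> p dvd k" "\<not> p dvd l" using that assms p_gt_1 by (auto dest!: dvd_imp_le)
    then have "\<not> p dvd k * l" using prime_p by (simp add: prime_dvd_mult_iff)
    moreover have "k * l mod p < p" using p_gt_1 by simp
    ultimately show ?thesis by (auto simp: dvd_eq_mod_eq_0)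
  qed
  then have "(\<lambda>k. k * l mod p) ` {1..p-1} \<subseteq> {1..p-1}" by blast
  from endo_inj_surj[OF finite_atLeastAtMost this inj] inj show ?thesis
    by (simp add: bij_betw_def)
qed

section \<open>Norms of integer polynomials in \<zeta>\<close>

text \<open>The field norm of \<open>f(\<zeta>)\<close>, written out over the conjugates so that it
  can be used before the Galois group is known.\<close>

definition conj_norm :: "int poly \<Rightarrow> complex" where
  "conj_norm f = (\<Prod>k=1..p-1. ieval f (\<zeta> ^ k))"

text \<open>
  Put \<open>F(x) = \<Prod>\<^sub>k f(x\<^sup>k)\<close>. At every nontrivial \<open>p\<close>-th root of unity \<open>F\<close> takes the value
  \<open>conj_norm f\<close>, and the sum of \<open>F\<close> over all \<open>p\<close>-th roots of unity is \<open>p\<close> times the sum of those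
  coefficients of \<open>F\<close> whose index is divisible by \<open>p\<close>.
\<close>
lemma conj_norm_relation:
  obtains b :: int where
    "of_int (poly f 1 ^ (p - 1)) + of_nat (p - 1) * conj_norm f = of_nat p * of_int b"
proof -
  define F where "F = (\<Prod>k=1..p-1. pcompose f (Polynomial.monom 1 k))"
  have F: "ieval F z = (\<Prod>k=1..p-1. ieval f (z ^ k))" for z
    by (simp add: F_def)
  have F1: "ieval F 1 = of_int (poly f 1 ^ (p - 1))"
    using ieval_of_int[of f 1] by (simp add: F)
  have Fl: "ieval F (\<zeta> ^ l) = conj_norm f" if "l \<in> {1..p-1}" for l
  proof -
    have "ieval F (\<zeta> ^ l) = (\<Prod>k=1..p-1. ieval f (\<zeta> ^ (k * l mod p)))"
      by (simp add: F zeta_power_mod power_mult [symmetric] mult_ac)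
    also have "\<dots> = conj_norm f" unfolding conj_norm_def
      by (rule prod.reindex_bij_betw[OF bij_betw_mult_mod[OF that]])
    finally show ?thesis .
  qed
  have "{..<p} = insert 0 {1..p-1}" using p_gt_1 by auto
  then have "(\<Sum>l<p. ieval F (\<zeta> ^ l)) = ieval F 1 + (\<Sum>l=1..p-1. ieval F (\<zeta> ^ l))" by simp
  also have "\<dots> = of_int (poly f 1 ^ (p - 1)) + of_nat (p - 1) * conj_norm f"
    by (simp add: F1 Fl)
  finally have lhs: "(\<Sum>l<p. ieval F (\<zeta> ^ l)) = \<dots>" .
  have "(\<Sum>l<p. ieval F (\<zeta> ^ l)) =
      (\<Sum>i\<le>Polynomial.degree F. of_int (poly.coeff F i) * (\<Sum>l<p. \<zeta> ^ (l * i)))"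
    unfolding ieval_altdef by (subst sum.swap) (simp add: sum_distrib_left power_mult)
  also have "\<dots> = (\<Sum>i\<le>Polynomial.degree F. of_int (if p dvd i then int p * poly.coeff F i else 0))"
    by (intro sum.cong) (auto simp: sum_zeta_power)
  also have "\<dots> = of_nat p * of_int (\<Sum>i\<le>Polynomial.degree F. if p dvd i then poly.coeff F i else 0)"
    by (simp add: sum_distrib_left if_distrib cong: if_cong)
  finally show ?thesis using lhs that by metis
qed

text \<open>The factor with \<open>k = 1\<close> makes the norm vanish, so
  \<open>conj_norm_relation\<close> leaves \<open>f(1)^(p-1)\<close> as a multiple of the prime
  \<open>p\<close>.\<close>

lemma p_dvd_poly_1:
  assumes "ieval f \<zeta> = 0"
  shows "int p dvd poly f 1"
proof -
  have "conj_norm f = 0"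
    unfolding conj_norm_def using assms p_gt_1 by (intro prod_zero) (auto intro!: bexI[of _ 1])
  then obtain b where "of_int (poly f 1 ^ (p - 1)) = (of_nat p * of_int b :: complex)"
    using conj_norm_relation[of f] by auto
  then have "of_int (poly f 1 ^ (p - 1)) = (of_int (int p * b) :: complex)" by simp
  then have "poly f 1 ^ (p - 1) = int p * b" unfolding of_int_eq_iff .
  then have "int p dvd poly f 1 ^ (p - 1)" by simp
  then show ?thesis using prime_p prime_dvd_power by (metis prime_nat_int_transfer)
qed

text \<open>The polynomial \<open>((y + 1)\<^sup>p - 1) / y\<close>.\<close>
definition eisenstein :: "int poly" where
  "eisenstein = (\<Sum>i<p. Polynomial.monom (int (p choose Suc i)) i)"

lemma coeff_eisenstein: "poly.coeff eisenstein i = (if i < p then int (p choose Suc i) else 0)"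
  by (simp add: eisenstein_def coeff_sum if_distrib[of "poly.coeff _"] cong: if_cong)

lemma p_dvd_coeff_eisenstein: "i < p - 1 \<Longrightarrow> int p dvd poly.coeff eisenstein i"
  using prime_p by (auto simp: coeff_eisenstein intro!: dvd_choose_prime)

text \<open>After multiplication by \<open>\<zeta> - 1\<close> the binomial theorem gives
  \<open>\<zeta>^p - 1 = 0\<close>, and the factor \<open>\<zeta> - 1\<close> is nonzero.\<close>

lemma ieval_eisenstein: "ieval eisenstein (\<zeta> - 1) = 0"
proof -
  have "(\<zeta> - 1) * ieval eisenstein (\<zeta> - 1) = (\<Sum>i<p. of_nat (p choose Suc i) * (\<zeta> - 1) ^ Suc i)"
    by (simp add: eisenstein_def sum_distrib_left mult_ac)
  also have "\<dots> = (\<Sum>i\<le>p. of_nat (p choose i) * (\<zeta> - 1) ^ i) - 1"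
    using sum.atMost_shift[of "\<lambda>i. of_nat (p choose i) * (\<zeta> - 1) ^ i" p] by simp
  also have "\<dots> = ((\<zeta> - 1) + 1) ^ p - 1"
    by (subst binomial_ring) simp
  also have "\<dots> = 0" by simp
  finally show ?thesis using zeta_power_eq_1_iff[of 1] p_gt_1 by auto
qed

text \<open>
  Modulo \<open>p\<close>, the polynomial \<^const>\<open>eisenstein\<close> is \<open>y\<^sup>p\<^sup>-\<^sup>1\<close>. So subtracting a multiple of it to kill the
  constant term and then dividing by \<open>y\<close> shifts the low coefficients down without changing them
  modulo \<open>p\<close>.
\<close>
lemma p_dvd_coeff:
  assumes "ieval F (\<zeta> - 1) = 0" and "j < p - 1"
  shows "int p dvd poly.coeff F j"
  using assms
proof (induction j arbitrary: F)
  case 0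
  have "ieval (pcompose F [:-1, 1:]) \<zeta> = 0" using 0 by (simp add: algebra_simps)
  from p_dvd_poly_1[OF this] show ?case by (simp add: poly_pcompose poly_0_coeff_0)
next
  case (Suc j)
  have "ieval (pcompose F [:-1, 1:]) \<zeta> = 0" using Suc by (simp add: algebra_simps)
  from p_dvd_poly_1[OF this] have "int p dvd poly.coeff F 0" by (simp add: poly_pcompose poly_0_coeff_0)
  then obtain m where m: "poly.coeff F 0 = int p * m" by (rule dvdE)
  define G where "G = F - smult m eisenstein"
  obtain a G1 where G1: "G = pCons a G1" by (rule pCons_cases)
  have "poly.coeff G 0 = 0" using m p_gt_1 by (simp add: G_def coeff_eisenstein)
  then have a: "a = 0" using G1 by simp
  have "ieval G (\<zeta> - 1) = 0" using Suc.prems by (simp add: G_def ieval_eisenstein)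
  then have "(\<zeta> - 1) * ieval G1 (\<zeta> - 1) = 0" by (simp add: G1 a)
  then have "ieval G1 (\<zeta> - 1) = 0" using zeta_power_eq_1_iff[of 1] p_gt_1 by auto
  then have "int p dvd poly.coeff G1 j" using Suc by simp
  moreover have "poly.coeff G1 j = poly.coeff F (Suc j) - m * poly.coeff eisenstein (Suc j)"
    using G1 by (metis G_def coeff_diff coeff_pCons_Suc coeff_smult)
  moreover have "int p dvd m * poly.coeff eisenstein (Suc j)"
    using Suc.prems p_dvd_coeff_eisenstein by simp
  ultimately show ?case by (metis dvd_add_right_iff diff_add_cancel)
qed

text \<open>Linear independence of the powers of \<open>\<zeta>\<close> below \<open>p - 1\<close>.
  In the variable \<open>\<zeta> - 1\<close>, \<open>p_dvd_coeff\<close> reaches every coefficient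
  that the degree bound allows.\<close>

lemma ieval_zeta_eq_0:
  assumes "ieval f \<zeta> = 0" and "Polynomial.degree f < p - 1"
  shows "f = 0"
proof (rule ccontr)
  assume "f \<noteq> 0"
  define F where "F = pcompose f [:1, 1:]"
  have deg: "Polynomial.degree F < p - 1" using assms by (simp add: F_def degree_pcompose)
  have F: "ieval F (\<zeta> - 1) = 0" using assms by (simp add: F_def)
  have F0: "F \<noteq> 0" using \<open>f \<noteq> 0\<close> by (simp add: F_def pcompose_eq_0_iff)
  \<comment> \<open>The primitive part still vanishes at \<open>\<zeta> - 1\<close>, but its content
    is 1; this replaces an infinite descent on powers of \<open>p\<close>.\<close>
  define H where "H = primitive_part F"
  have FH: "F = smult (content F) H" by (simp add: H_def)
  have "ieval F (\<zeta> - 1) = of_int (content F) * ieval H (\<zeta> - 1)" by (subst FH) simp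
  with F F0 have H: "ieval H (\<zeta> - 1) = 0" by simp
  have "int p dvd poly.coeff H j" for j
  proof (cases "j < p - 1")
    case False
    then have "poly.coeff H j = 0" using deg by (intro coeff_eq_0) (simp add: H_def)
    then show ?thesis by simp
  qed (use p_dvd_coeff[OF H] in auto)
  then have "[:int p:] dvd H" by (simp add: const_poly_dvd_iff)
  then have "int p dvd content H" by (simp add: const_poly_dvd_iff_dvd_content)
  then have "int p dvd 1" using F0 by (simp add: H_def)
  then show False using p_gt_1 by simp
qed

section \<open>Conjugates and inverses\<close>

lemma inverse_mod_p:
  assumes "k \<in> {1..p-1}"
  obtains m where "m \<in> {1..p-1}" "\<zeta> ^ (k * m) = \<zeta>"
proof -
  have "1 \<in> (\<lambda>m. m * k mod p) ` {1..p-1}"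
    using bij_betw_mult_mod[OF assms] p_gt_1 by (simp add: bij_betw_def)
  then obtain m where m: "m \<in> {1..p-1}" "m * k mod p = 1" by auto
  then have "\<zeta> ^ (k * m) = \<zeta>" using zeta_power_mod[of "m * k"] by (simp add: mult.commute)
  with m that show ?thesis by blast
qed

text \<open>Up to an integer factor, an \<open>f\<close> vanishing at \<open>\<zeta>\<close> is a
  multiple of the cyclotomic polynomial \<open>1 + x + ... + x^(p-1)\<close>, which vanishes at all
  nontrivial \<open>p\<close>-th roots of unity.\<close>

lemma ieval_zeta_power_eq_0_iff:
  assumes "k \<in> {1..p-1}"
  shows "ieval f (\<zeta> ^ k) = 0 \<longleftrightarrow> ieval f \<zeta> = 0"
proof -
  have imp: "ieval f (\<zeta> ^ k) = 0" if "ieval f \<zeta> = 0" and k: "k \<in> {1..p-1}" for f k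
  proof -
    define \<Phi> :: "int poly" where "\<Phi> = (\<Sum>i<p. Polynomial.monom 1 i)"
    have \<Phi>: "ieval \<Phi> (\<zeta> ^ k) = 0" if "k \<in> {1..p-1}" for k
    proof -
      have "\<not> p dvd k" using that p_gt_1 by (auto dest!: dvd_imp_le)
      then show ?thesis
        using sum_zeta_power[of k] by (simp add: \<Phi>_def power_mult [symmetric] mult.commute)
    qed
    have coeff: "poly.coeff \<Phi> i = (if i < p then 1 else 0)" for i
      by (simp add: \<Phi>_def coeff_sum if_distrib[of "poly.coeff _"] cong: if_cong)
    then have "\<Phi> \<noteq> 0" using p_gt_1 by (metis coeff_0 zero_neq_one less_trans zero_less_one)
    have deg: "Polynomial.degree \<Phi> \<le> p - 1" using coeff by (intro degree_le) auto
    \<comment> \<open>Division with remainder over the integers needs the factor \<open>a\<close>.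
      The remainder vanishes at \<open>\<zeta>\<close> and has degree below \<open>p - 1\<close>,
      hence is zero.\<close>
    obtain a q where aq: "a \<noteq> 0" "smult a f = \<Phi> * q + pseudo_mod f \<Phi>"
      using pseudo_mod(1)[OF \<open>\<Phi> \<noteq> 0\<close>] by blast
    have "ieval (smult a f) \<zeta> = 0" using that by simp
    then have r: "ieval (pseudo_mod f \<Phi>) \<zeta> = 0" using \<Phi>[of 1] p_gt_1 by (simp add: aq)
    have r0: "pseudo_mod f \<Phi> = 0"
      using pseudo_mod(2)[OF \<open>\<Phi> \<noteq> 0\<close>, of f] ieval_zeta_eq_0[OF r] deg by linarith
    then have "ieval (smult a f) (\<zeta> ^ k) = 0" using \<Phi>[OF k] by (simp add: aq r0)
    with aq(1) show ?thesis by simp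
  qed
  obtain m where m: "m \<in> {1..p-1}" "\<zeta> ^ (k * m) = \<zeta>" using inverse_mod_p[OF assms] .
  \<comment> \<open>For the converse, \<open>f(x^k)\<close> vanishes at \<open>\<zeta>\<close>,
    hence at \<open>\<zeta>^m\<close>, where its value is
    \<open>f(\<zeta>^(k m)) = f(\<zeta>)\<close>.\<close>
  have "ieval f \<zeta> = 0" if "ieval f (\<zeta> ^ k) = 0"
    using imp[of "pcompose f (Polynomial.monom 1 k)", OF _ m(1)] that m(2)
    by (simp add: power_mult [symmetric] mult.commute)
  with imp assms show ?thesis by blast
qed

text \<open>Clearing denominators reduces this to the vanishing of one polynomial. One direction
  makes \<open>\<zeta> \<mapsto> \<zeta>^k\<close> well defined on fractions, the other makes it
  injective.\<close>

lemma ieval_zeta_power_eq_iff: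
  assumes "k \<in> {1..p-1}" "m \<noteq> 0" "n \<noteq> 0"
  shows "ieval f (\<zeta> ^ k) / of_int m = ieval g (\<zeta> ^ k) / of_int n \<longleftrightarrow>
    ieval f \<zeta> / of_int m = ieval g \<zeta> / of_int n"
proof -
  have "ieval f z / of_int m = ieval g z / of_int n \<longleftrightarrow> ieval (smult n f - smult m g) z = 0" for z
    using assms by (simp add: field_simps)
  then show ?thesis using ieval_zeta_power_eq_0_iff[OF assms(1)] by presburger
qed

text \<open>The product \<open>g\<close> of the other conjugates is an integer polynomial in
  \<open>\<zeta>\<close>, and \<open>f(\<zeta>) g(\<zeta>)\<close> is the norm. By
  \<open>conj_norm_relation\<close> its multiple by \<open>p - 1\<close> is an integer
  \<open>c\<close>, nonzero because no conjugate of \<open>f(\<zeta>)\<close> vanishes.\<close>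

lemma inverse_ieval:
  assumes "ieval f \<zeta> \<noteq> 0"
  obtains g m where "m \<noteq> 0" "inverse (ieval f \<zeta>) = ieval g \<zeta> / of_int m"
proof -
  define g where "g = (\<Prod>k=2..p-1. pcompose f (Polynomial.monom 1 k))"
  have split: "{1..p-1} = insert 1 {2..p-1}" using p_gt_1 by auto
  have norm: "conj_norm f = ieval f \<zeta> * ieval g \<zeta>"
    unfolding conj_norm_def split by (simp add: g_def)
  obtain b where "of_int (poly f 1 ^ (p - 1)) + of_nat (p - 1) * conj_norm f = of_nat p * (of_int b :: complex)"
    using conj_norm_relation[of f] by metis
  then have c: "of_nat (p - 1) * conj_norm f = of_int (int p * b - poly f 1 ^ (p - 1))"
    by (simp add: algebra_simps)
  define c where "c = int p * b - poly f 1 ^ (p - 1)"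
  have "conj_norm f \<noteq> 0"
    using assms ieval_zeta_power_eq_0_iff[of _ f] by (auto simp: conj_norm_def)
  then have "(of_int c :: complex) \<noteq> 0" unfolding c_def c [symmetric] using p_gt_1 by simp
  moreover have "ieval f \<zeta> * ieval (smult (int (p - 1)) g) \<zeta> = of_int c"
    unfolding c_def c [symmetric] norm by simp
  ultimately show ?thesis
    using assms that[of c "smult (int (p - 1)) g"] by (simp add: field_simps)
qed

subsection \<open>Elements and automorphisms of the cyclotomic field\<close>

lemma Rats_in_cyclotomic_field [simp]: "q \<in> \<rat> \<Longrightarrow> q \<in> cyclotomic_field p"
  by (auto simp: cyclotomic_field_def intro: generate_field.incl)

lemma zeta_in_cyclotomic_field [simp]: "\<zeta> \<in> cyclotomic_field p"
  by (auto simp: cyclotomic_field_def intro: generate_field.incl)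

lemma cyclotomic_field_add:
  "x \<in> cyclotomic_field p \<Longrightarrow> y \<in> cyclotomic_field p \<Longrightarrow> x + y \<in> cyclotomic_field p"
  using generate_field.eng_add[of x complex_ring] by (simp add: cyclotomic_field_def)

lemma cyclotomic_field_mult:
  "x \<in> cyclotomic_field p \<Longrightarrow> y \<in> cyclotomic_field p \<Longrightarrow> x * y \<in> cyclotomic_field p"
  using generate_field.eng_mult[of x complex_ring] by (simp add: cyclotomic_field_def)

lemma ieval_in_cyclotomic_field:
  "z \<in> cyclotomic_field p \<Longrightarrow> ieval f z \<in> cyclotomic_field p"
  by (induction f) (auto intro!: cyclotomic_field_add cyclotomic_field_mult)

text \<open>The fractions are closed under the field operations; only inversion is not immediate,
  and \<open>inverse_ieval\<close> provides it.\<close>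

lemma cyclotomic_field_eq:
  "cyclotomic_field p = {ieval f \<zeta> / of_int n | f n. n \<noteq> 0}" (is "_ = ?Q")
proof (intro equalityI subsetI)
  have Q: "x \<in> ?Q" if "x = ieval f \<zeta> / of_int n" "n \<noteq> 0" for x f n
    using that by blast
  fix x assume "x \<in> cyclotomic_field p"
  then show "x \<in> ?Q" unfolding cyclotomic_field_def
  proof (induction rule: generate_field.induct)
    case one
    show ?case by (auto intro!: exI[of _ 1])
  next
    case (incl h)
    then consider "h \<in> \<rat>" | "h = \<zeta>" by blast
    then show ?case
    proof cases
      case 1
      then obtain a b where "b > 0" "h = of_int a / of_int b" by (rule Rats_cases')
      then show ?thesis by (auto intro!: exI[of _ "[:a:]"] exI[of _ b])
    next
      case 2
      then show ?thesis by (auto intro!: exI[of _ "[:0, 1:]"] exI[of _ "1 :: int"])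
    qed
  next
    case (a_inv h)
    then obtain f n where "n \<noteq> 0" "h = ieval f \<zeta> / of_int n" by blast
    then show ?case by (auto simp: complex_ring_uminus intro!: exI[of _ "- f"] exI[of _ n])
  next
    case (m_inv h)
    then obtain f n where fn: "n \<noteq> 0" "h = ieval f \<zeta> / of_int n" by blast
    with m_inv have "ieval f \<zeta> \<noteq> 0" by auto
    then obtain g m where "m \<noteq> 0" "inverse (ieval f \<zeta>) = ieval g \<zeta> / of_int m"
      by (rule inverse_ieval)
    then have "inverse h = ieval (smult n g) \<zeta> / of_int m"
      using fn by (simp add: divide_inverse mult_ac)
    moreover have "inv\<^bsub>complex_ring\<^esub> h = inverse h"
      using m_inv.hyps by (intro complex_ring_inverse) simp
    ultimately have "inv\<^bsub>complex_ring\<^esub> h = ieval (smult n g) \<zeta> / of_int m" by simp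
    then show ?case using \<open>m \<noteq> 0\<close> by (rule Q)
  next
    case (eng_add h1 h2)
    then obtain f n g m where "n \<noteq> 0" "h1 = ieval f \<zeta> / of_int n" "m \<noteq> 0" "h2 = ieval g \<zeta> / of_int m"
      by blast
    then have "h1 + h2 = ieval (smult m f + smult n g) \<zeta> / of_int (n * m)" "n * m \<noteq> 0"
      by (simp_all add: field_simps)
    then show ?case unfolding complex_ring_simps by (rule Q)
  next
    case (eng_mult h1 h2)
    then obtain f n g m where "n \<noteq> 0" "h1 = ieval f \<zeta> / of_int n" "m \<noteq> 0" "h2 = ieval g \<zeta> / of_int m"
      by blast
    then have "h1 * h2 = ieval (f * g) \<zeta> / of_int (n * m)" "n * m \<noteq> 0"
      by simp_all
    then show ?case unfolding complex_ring_simps by (rule Q)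
  qed
next
  fix x assume "x \<in> ?Q"
  then obtain f n where "n \<noteq> 0" "x = ieval f \<zeta> * inverse (of_int n)" by (auto simp: field_simps)
  moreover have "(inverse (of_int n) :: complex) \<in> \<rat>" by simp
  ultimately show "x \<in> cyclotomic_field p"
    by (auto intro!: cyclotomic_field_mult ieval_in_cyclotomic_field)
qed

lemma cyclotomic_fieldE:
  assumes "x \<in> cyclotomic_field p"
  obtains f n where "n \<noteq> 0" "x = ieval f \<zeta> / of_int n"
  using assms by (auto simp: cyclotomic_field_eq)

text \<open>The choice is unambiguous by \<open>ieval_zeta_power_eq_iff\<close>.\<close>
definition gal :: "nat \<Rightarrow> complex \<Rightarrow> complex" where
  "gal k = restrict (\<lambda>x. SOME y. \<exists>f n. n \<noteq> 0 \<and> x = ieval f \<zeta> / of_int n \<and>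
     y = ieval f (\<zeta> ^ k) / of_int n) (cyclotomic_field p)"

lemma gal_ieval_div:
  assumes "k \<in> {1..p-1}" "n \<noteq> 0"
  shows "gal k (ieval f \<zeta> / of_int n) = ieval f (\<zeta> ^ k) / of_int n"
proof -
  have "ieval f \<zeta> / of_int n \<in> cyclotomic_field p" using assms by (auto simp: cyclotomic_field_eq)
  moreover have "(SOME y. \<exists>g m. m \<noteq> 0 \<and> ieval f \<zeta> / of_int n = ieval g \<zeta> / of_int m \<and>
     y = ieval g (\<zeta> ^ k) / of_int m) = ieval f (\<zeta> ^ k) / of_int n"
    using assms ieval_zeta_power_eq_iff[OF assms(1)] by (intro some_equality) metis+
  ultimately show ?thesis by (simp add: gal_def)
qed

lemma gal_ieval: "k \<in> {1..p-1} \<Longrightarrow> gal k (ieval f \<zeta>) = ieval f (\<zeta> ^ k)"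
  using gal_ieval_div[of k 1 f] by simp

lemma gal_in_galois_group:
  assumes k: "k \<in> {1..p-1}"
  shows "gal k \<in> galois_group p"
proof -
  let ?K = "cyclotomic_field p"
  have q: "gal k q = q" if q: "q \<in> \<rat>" for q
  proof -
    obtain a b where "b > 0" "q = of_int a / of_int b" using q by (rule Rats_cases')
    then show ?thesis using gal_ieval_div[OF k, of b "[:a:]"] by simp
  qed
  have K: "gal k x \<in> ?K" if x: "x \<in> ?K" for x
  proof -
    obtain f n where fn: "n \<noteq> 0" "x = ieval f \<zeta> / of_int n" using x by (rule cyclotomic_fieldE)
    then have "gal k x = ieval (pcompose f (Polynomial.monom 1 k)) \<zeta> / of_int n"
      using k by (simp add: gal_ieval_div)
    with fn(1) show ?thesis unfolding cyclotomic_field_eq by blast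
  qed
  have add: "gal k (x + y) = gal k x + gal k y" and mult: "gal k (x * y) = gal k x * gal k y"
    if x: "x \<in> ?K" and y: "y \<in> ?K" for x y
  proof -
    obtain f n where fn: "n \<noteq> 0" "x = ieval f \<zeta> / of_int n" using x by (rule cyclotomic_fieldE)
    obtain g m where gm: "m \<noteq> 0" "y = ieval g \<zeta> / of_int m" using y by (rule cyclotomic_fieldE)
    have nm: "n * m \<noteq> 0" using fn gm by simp
    \<comment> \<open>Over the common denominator \<open>n * m\<close>, sum and product each become
      a single fraction to which \<open>gal_ieval_div\<close> applies.\<close>
    have frac: "u / of_int n + v / of_int m = (of_int m * u + of_int n * v) / of_int (n * m)"
      "(u / of_int n) * (v / of_int m) = u * v / of_int (n * m)" for u v :: complex
      using fn(1) gm(1) by (simp_all add: add_frac_eq mult.commute)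
    have "gal k (x + y) = ieval (smult m f + smult n g) (\<zeta> ^ k) / of_int (n * m)"
      using gal_ieval_div[OF k nm, of "smult m f + smult n g"] by (simp only: fn(2) gm(2) frac ieval_add ieval_smult)
    moreover have "gal k (x * y) = ieval (f * g) (\<zeta> ^ k) / of_int (n * m)"
      using gal_ieval_div[OF k nm, of "f * g"] by (simp only: fn(2) gm(2) frac ieval_mult)
    moreover have "gal k x = ieval f (\<zeta> ^ k) / of_int n" "gal k y = ieval g (\<zeta> ^ k) / of_int m"
      unfolding fn(2) gm(2) using fn(1) gm(1) gal_ieval_div[OF k] by simp_all
    ultimately show "gal k (x + y) = gal k x + gal k y" "gal k (x * y) = gal k x * gal k y"
      by (simp_all only: frac ieval_add ieval_smult ieval_mult)
  qed
  have "inj_on (gal k) ?K"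
    by (intro inj_onI) (elim cyclotomic_fieldE, simp add: gal_ieval_div[OF k] ieval_zeta_power_eq_iff[OF k])
  moreover have "?K \<subseteq> gal k ` ?K"
  proof
    fix x assume "x \<in> ?K"
    then obtain f n where fn: "n \<noteq> 0" "x = ieval f \<zeta> / of_int n" by (rule cyclotomic_fieldE)
    obtain m where m: "m \<in> {1..p-1}" "\<zeta> ^ (k * m) = \<zeta>" using inverse_mod_p[OF k] .
    \<comment> \<open>The preimage comes from the inverse exponent: \<open>\<zeta>\<close> is
      replaced by \<open>\<zeta>^m\<close> in \<open>x\<close>.\<close>
    let ?y = "ieval (pcompose f (Polynomial.monom 1 m)) \<zeta> / of_int n"
    have "gal k ?y = x" using fn m gal_ieval_div[OF k fn(1), of "pcompose f (Polynomial.monom 1 m)"]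
      by (simp add: power_mult [symmetric])
    moreover have "?y \<in> ?K" using fn unfolding cyclotomic_field_eq by blast
    ultimately show "x \<in> gal k ` ?K" by (metis imageI)
  qed
  ultimately have "bij_betw (gal k) ?K ?K" using K by (auto simp: bij_betw_def)
  moreover have "gal k \<in> extensional ?K" by (simp add: gal_def)
  ultimately show ?thesis using q K add mult
    by (auto simp: galois_group_def Let_def ring_iso_def ring_hom_def)
qed

text \<open>An automorphism commutes with integer polynomials, so it is determined by the image of
  \<open>\<zeta>\<close>, which is again a \<open>p\<close>-th root of unity and differs from 1 by
  injectivity.\<close>

lemma galois_group_eq: "galois_group p = gal ` {1..p-1}"
proof (intro equalityI subsetI)
  let ?K = "cyclotomic_field p"
  fix \<sigma> assume "\<sigma> \<in> galois_group p"
  then have q: "\<And>q. q \<in> \<rat> \<Longrightarrow> \<sigma> q = q" and ext: "\<sigma> \<in> extensional ?K" and bij: "bij_betw \<sigma> ?K ?K"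
    and add: "\<And>x y. x \<in> ?K \<Longrightarrow> y \<in> ?K \<Longrightarrow> \<sigma> (x + y) = \<sigma> x + \<sigma> y"
    and mult: "\<And>x y. x \<in> ?K \<Longrightarrow> y \<in> ?K \<Longrightarrow> \<sigma> (x * y) = \<sigma> x * \<sigma> y"
    by (auto simp: galois_group_def Let_def ring_iso_def ring_hom_def)
  have int: "of_int n \<in> ?K" for n by simp
  have ieval: "\<sigma> (ieval f \<zeta>) = ieval f (\<sigma> \<zeta>)" for f
  proof (induction f)
    case (pCons a f)
    then show ?case
      using add[OF int, of "\<zeta> * ieval f \<zeta>" a] mult[of \<zeta> "ieval f \<zeta>"]
      by (simp add: cyclotomic_field_mult ieval_in_cyclotomic_field q)
  qed (simp add: q)
  have "ieval (Polynomial.monom 1 p) \<zeta> = 1" by simp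
  then have "(\<sigma> \<zeta>) ^ p = 1" using ieval[of "Polynomial.monom 1 p"] by (simp add: q)
  then obtain k where k: "k < p" "\<sigma> \<zeta> = \<zeta> ^ k" by (rule root_of_unityE)
  have "\<sigma> \<zeta> \<noteq> \<sigma> 1"
    using inj_on_eq_iff[OF bij_betw_imp_inj_on[OF bij], of \<zeta> 1] int[of 1] zeta_power_eq_1_iff[of 1] p_gt_1
    by simp
  then have "\<sigma> \<zeta> \<noteq> 1" by (simp add: q)
  then have "k \<noteq> 0" using k by (metis power_0)
  with k have k': "k \<in> {1..p-1}" by auto
  have "\<sigma> x = gal k x" for x
  proof (cases "x \<in> ?K")
    case True
    then obtain f n where fn: "n \<noteq> 0" "x = ieval f \<zeta> / of_int n" by (rule cyclotomic_fieldE)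
    then have "\<sigma> (of_int n * x) = ieval f (\<zeta> ^ k)" using ieval[of f] k by simp
    then have "\<sigma> x = ieval f (\<zeta> ^ k) / of_int n"
      using fn mult[OF int True, of n] by (simp add: q field_simps)
    then show ?thesis using fn k' gal_ieval_div by simp
  next
    case False
    \<comment> \<open>Outside the field both functions are \<open>undefined\<close>, so they agree
      as HOL functions.\<close>
    then show ?thesis using ext by (simp add: gal_def extensional_def)
  qed
  then show "\<sigma> \<in> gal ` {1..p-1}" using k' by blast
qed (use gal_in_galois_group in blast)

lemma inj_on_gal: "inj_on gal {1..p-1}"
proof (rule inj_onI)
  fix j k assume jk: "j \<in> {1..p-1}" "k \<in> {1..p-1}" "gal j = gal k"
  then have "\<zeta> ^ j = \<zeta> ^ k" using gal_ieval[of j "[:0, 1:]"] gal_ieval[of k "[:0, 1:]"] by simp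
  then show "j = k" using jk p_gt_1 by (intro inj_onD[OF zeta_power_inj]) auto
qed

lemma cyc_trace_ieval: "cyc_trace p (ieval f \<zeta>) = (\<Sum>k=1..p-1. ieval f (\<zeta> ^ k))"
  unfolding cyc_trace_def galois_group_eq
  by (subst sum.reindex[OF inj_on_gal]) (auto simp: gal_ieval intro!: sum.cong)

subsection \<open>Trace and norm of integer combinations\<close>

definition lincomb :: "(nat \<Rightarrow> int) \<Rightarrow> complex" where
  "lincomb c = (\<Sum>j=1..p-1. of_int (c j) * \<zeta> ^ j)"

text \<open>The trace of \<open>\<zeta>^i\<close> is \<open>p - 1\<close> if \<open>p\<close>
  divides \<open>i\<close> and \<open>-1\<close> otherwise. As \<open>j + l\<close> lies strictly
  between 0 and \<open>2 p\<close>, the first case occurs only for \<open>j = p - l\<close>.\<close>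

lemma cyc_trace_lincomb:
  assumes l: "l \<in> {1..p-1}"
  shows "cyc_trace p (lincomb c * \<zeta> ^ l) = of_int (int p * c (p - l) - (\<Sum>j=1..p-1. c j))"
proof -
  have dvd: "p dvd j + l \<longleftrightarrow> j = p - l" if "j \<in> {1..p-1}" for j
  proof
    assume "p dvd j + l"
    then obtain q where q: "j + l = p * q" by (rule dvdE)
    have "j + l < p * 2" "0 < j + l" using that l p_gt_1 by auto
    then have "q < 2" "0 < q" using q by (auto simp: mult_less_cancel1)
    then have "q = 1" by simp
    with q show "j = p - l" by simp
  qed (use l in auto)
  let ?f = "\<Sum>j=1..p-1. Polynomial.monom (c j) (j + l)"
  have "lincomb c * \<zeta> ^ l = ieval ?f \<zeta>"
    by (simp add: lincomb_def sum_distrib_right power_add mult.assoc)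
  then have "cyc_trace p (lincomb c * \<zeta> ^ l) = (\<Sum>k=1..p-1. \<Sum>j=1..p-1. of_int (c j) * \<zeta> ^ (k * (j + l)))"
    by (simp only: cyc_trace_ieval) (simp add: power_mult)
  also have "\<dots> = (\<Sum>j=1..p-1. of_int (c j) * (\<Sum>k=1..p-1. \<zeta> ^ (k * (j + l))))"
    by (subst sum.swap) (simp add: sum_distrib_left)
  also have "\<dots> = (\<Sum>j=1..p-1. of_int ((if j = p - l then int p * c j else 0) - c j))"
    unfolding sum_nontrivial_zeta_power by (intro sum.cong) (auto simp: dvd algebra_simps)
  also have "\<dots> = of_int (\<Sum>j=1..p-1. (if j = p - l then int p * c j else 0) - c j)"
    by (rule of_int_sum [symmetric])
  also have "(\<Sum>j=1..p-1. (if j = p - l then int p * c j else 0) - c j) = int p * c (p - l) - (\<Sum>j=1..p-1. c j)"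
    using l p_gt_1 by (auto simp: sum_subtractf)
  finally show ?thesis .
qed

lemma cyc_norm_lincomb:
  "cyc_norm p (lincomb c) = sqrt (of_int (\<Sum>j=1..p-1. (int p * c j - (\<Sum>i=1..p-1. c i))\<^sup>2))"
proof -
  let ?S = "\<Sum>i=1..p-1. c i"
  have "(\<Sum>j=1..p-1. (cyc_trace p (lincomb c * \<zeta> ^ j))\<^sup>2) = (\<Sum>j=1..p-1. of_int ((int p * c (p - j) - ?S)\<^sup>2))"
    by (intro sum.cong) (simp_all add: cyc_trace_lincomb)
  also have "\<dots> = of_int (\<Sum>j=1..p-1. (int p * c (p - j) - ?S)\<^sup>2)" by simp
  also have "(\<Sum>j=1..p-1. (int p * c (p - j) - ?S)\<^sup>2) = (\<Sum>j=1..p-1. (int p * c j - ?S)\<^sup>2)"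
    by (intro sum.reindex_bij_witness[of _ "\<lambda>j. p - j" "\<lambda>j. p - j"]) auto
  finally show ?thesis by (simp add: cyc_norm_def del: of_int_sum)
qed

text \<open>With \<open>S\<close> the sum of the coefficients, expanding the squares contributes
  \<open>- 2 p S^2 + (p - 1) S^2 = - (p + 1) S^2\<close>.\<close>

lemma cyc_norm_lincomb_sq:
  "(cyc_norm p (lincomb c))\<^sup>2 = (real p)\<^sup>2 * (\<Sum>j=1..p-1. (of_int (c j))\<^sup>2) - (real p + 1) * (of_int (\<Sum>j=1..p-1. c j))\<^sup>2"
proof -
  let ?S = "\<Sum>i=1..p-1. c i"
  have "(cyc_norm p (lincomb c))\<^sup>2 = (\<Sum>j=1..p-1. (real p * of_int (c j) - of_int ?S)\<^sup>2)"
    by (simp add: cyc_norm_lincomb sum_nonneg)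
  also have "\<dots> = (\<Sum>j=1..p-1. (real p)\<^sup>2 * (of_int (c j))\<^sup>2 - 2 * real p * of_int ?S * of_int (c j) + (of_int ?S)\<^sup>2)"
    by (intro sum.cong) (simp_all add: power2_diff power_mult_distrib algebra_simps)
  also have "\<dots> = (real p)\<^sup>2 * (\<Sum>j=1..p-1. (of_int (c j))\<^sup>2) - 2 * real p * of_int ?S * of_int ?S + real (p - 1) * (of_int ?S)\<^sup>2"
    by (simp only: sum.distrib sum_subtractf sum_distrib_left [symmetric] of_int_sum [symmetric]) simp
  also have "\<dots> = (real p)\<^sup>2 * (\<Sum>j=1..p-1. (of_int (c j))\<^sup>2) - (real p + 1) * (of_int ?S)\<^sup>2"
    using p_gt_1 by (simp add: of_nat_diff power2_eq_square algebra_simps del: of_int_sum)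
  finally show ?thesis .
qed

text \<open>Traces recover coordinates: if \<open>lincomb e = 0\<close>, then every
  \<open>p * e i\<close> equals the sum \<open>S\<close> of all coordinates.\<close>

lemma lincomb_inj:
  assumes "lincomb c = lincomb d" "j \<in> {1..p-1}"
  shows "c j = d j"
proof -
  define e where "e = (\<lambda>j. c j - d j)"
  let ?S = "\<Sum>i=1..p-1. e i"
  have "lincomb e = 0" using assms(1) by (simp add: lincomb_def e_def sum_subtractf algebra_simps)
  moreover have "cyc_trace p 0 = 0" using cyc_trace_ieval[of 0] by simp
  ultimately have *: "int p * e (p - l) = ?S" if "l \<in> {1..p-1}" for l
    using cyc_trace_lincomb[OF that, of e]
    by (simp only: mult_zero_left of_int_0_eq_iff)
  have e: "int p * e i = ?S" if "i \<in> {1..p-1}" for i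
  proof -
    have "p - i \<in> {1..p-1}" "p - (p - i) = i" using that by auto
    with * show ?thesis by metis
  qed
  \<comment> \<open>Summing over \<open>i\<close> gives \<open>p S = (p - 1) S\<close>, hence
    \<open>S = 0\<close>.\<close>
  have "int p * ?S = (\<Sum>i=1..p-1. ?S)" unfolding sum_distrib_left using e by (intro sum.cong) auto
  then have "?S = 0" using p_gt_1 by (simp add: of_nat_diff algebra_simps)
  with e[OF assms(2)] p_gt_1 show ?thesis by (simp add: e_def)
qed

section \<open>Vertices as sign vectors and distances in coordinates\<close>

lemma cyc_vertices_eq:
  "cyc_vertices p N = lincomb ` Pi\<^sub>E {1..p-1} (\<lambda>_. {-N, N})"
proof (intro equalityI subsetI)
  fix x assume "x \<in> cyc_vertices p N"
  then obtain a where a: "\<forall>j\<in>{1..p-1}. a j \<in> {-N, N}" "x = lincomb a"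
    by (auto simp: cyc_vertices_def lincomb_def)
  \<comment> \<open>The coefficients are arbitrary outside the index range; restricting them fixes
    one representative without changing the sum.\<close>
  then have "x = lincomb (restrict a {1..p-1})" "restrict a {1..p-1} \<in> Pi\<^sub>E {1..p-1} (\<lambda>_. {-N, N})"
    by (auto simp: lincomb_def intro!: sum.cong)
  then show "x \<in> lincomb ` Pi\<^sub>E {1..p-1} (\<lambda>_. {-N, N})" by blast
next
  fix x assume "x \<in> lincomb ` Pi\<^sub>E {1..p-1} (\<lambda>_. {-N, N})"
  then obtain a where "a \<in> Pi\<^sub>E {1..p-1} (\<lambda>_. {-N, N})" "x = lincomb a" by blast
  then show "x \<in> cyc_vertices p N"
    unfolding cyc_vertices_def lincomb_def by (intro CollectI exI[of _ a]) (auto simp: PiE_iff)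
qed

text \<open>Turns averages over vertices into averages over sign vectors.\<close>

lemma inj_on_lincomb: "inj_on lincomb (Pi\<^sub>E {1..p-1} T)"
  by (intro inj_onI) (blast intro: PiE_ext lincomb_inj)

lemma lincomb_diff: "lincomb b - lincomb a = lincomb (\<lambda>j. b j - a j)"
  by (simp add: lincomb_def sum_subtractf algebra_simps)

lemma cyc_dist_lincomb_nonneg: "N \<ge> 0 \<Longrightarrow> 0 \<le> cyc_dist p N (lincomb a) (lincomb b)"
  by (simp add: cyc_dist_def lincomb_diff cyc_norm_lincomb sum_nonneg)

lemma cyc_dist_lincomb_sq:
  "(cyc_dist p N (lincomb a) (lincomb b))\<^sup>2 =
     ((real p)\<^sup>2 * (\<Sum>j=1..p-1. (real_of_int (b j) - real_of_int (a j))\<^sup>2)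
       - (real p + 1) * ((\<Sum>j=1..p-1. real_of_int (b j)) - (\<Sum>j=1..p-1. real_of_int (a j)))\<^sup>2)
     / (4 * (real_of_int N)\<^sup>2 * (real p)\<^sup>2 * real (p - 1))"
  by (simp add: cyc_dist_def lincomb_diff power_divide power_mult_distrib cyc_norm_lincomb_sq sum_subtractf)

end

subsection \<open>Quadratic polynomials in random signs\<close>

text \<open>Splits off one random sign, the induction step for all moments below;
  \<open>N \<noteq> 0\<close> makes the two values distinct.\<close>

lemma sum_PiE_signs_insert:
  fixes N :: int and g :: "('a \<Rightarrow> int) \<Rightarrow> real"
  assumes "x \<notin> I" "N \<noteq> 0"
  shows "(\<Sum>b\<in>Pi\<^sub>E (insert x I) (\<lambda>_. {-N, N}). g b) =
    (\<Sum>b\<in>Pi\<^sub>E I (\<lambda>_. {-N, N}). g (b(x := N)) + g (b(x := -N)))"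
proof -
  have "(\<Sum>b\<in>Pi\<^sub>E (insert x I) (\<lambda>_. {-N, N}). g b) =
      (\<Sum>(y, b)\<in>{-N, N} \<times> Pi\<^sub>E I (\<lambda>_. {-N, N}). g (b(x := y)))"
    unfolding PiE_insert_eq
    by (subst sum.reindex[OF inj_combinator[OF assms(1)]]) (simp add: case_prod_beta)
  also have "\<dots> = (\<Sum>y\<in>{-N, N}. \<Sum>b\<in>Pi\<^sub>E I (\<lambda>_. {-N, N}). g (b(x := y)))"
    by (rule sum.cartesian_product [symmetric])
  also have "\<dots> = (\<Sum>b\<in>Pi\<^sub>E I (\<lambda>_. {-N, N}). g (b(x := N)) + g (b(x := -N)))"
    using assms by (simp add: sum.distrib add.commute)
  finally show ?thesis .
qed

lemma sum_fun_upd_insert: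
  fixes l :: "'a \<Rightarrow> real" and b :: "'a \<Rightarrow> int"
  assumes "finite I" "x \<notin> I"
  shows "(\<Sum>i\<in>insert x I. l i * real_of_int ((b(x := y)) i)) = l x * real_of_int y + (\<Sum>i\<in>I. l i * real_of_int (b i))"
proof -
  have "(\<Sum>i\<in>I. l i * real_of_int ((b(x := y)) i)) = (\<Sum>i\<in>I. l i * real_of_int (b i))"
    using assms(2) by (intro sum.cong) auto
  then show ?thesis using assms by simp
qed

lemma card_PiE_signs:
  fixes N :: int
  assumes "finite I" "N \<noteq> 0"
  shows "card (Pi\<^sub>E I (\<lambda>_. {-N, N})) = 2 ^ card I"
  using assms by (simp add: card_PiE numeral_2_eq_2)

lemma sum_signs_linear:
  fixes N :: int and l :: "'a \<Rightarrow> real"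
  assumes "finite I" "N \<noteq> 0"
  shows "(\<Sum>b\<in>Pi\<^sub>E I (\<lambda>_. {-N, N}). \<Sum>i\<in>I. l i * real_of_int (b i)) = 0"
  using assms(1)
proof (induction I)
  case (insert x I)
  then show ?case
    by (subst sum_PiE_signs_insert[OF insert(2) assms(2)])
      (simp only: sum_fun_upd_insert[OF insert(1,2)], simp add: sum_distrib_left [symmetric])
qed simp

lemma sum_signs_linear_sq:
  fixes N :: int and l :: "'a \<Rightarrow> real"
  assumes "finite I" "N \<noteq> 0"
  shows "(\<Sum>b\<in>Pi\<^sub>E I (\<lambda>_. {-N, N}). (\<Sum>i\<in>I. l i * real_of_int (b i))\<^sup>2) = 2 ^ card I * (real_of_int N)\<^sup>2 * (\<Sum>i\<in>I. (l i)\<^sup>2)"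
  using assms(1)
proof (induction I)
  case (insert x I)
  have "(\<Sum>b\<in>Pi\<^sub>E (insert x I) (\<lambda>_. {-N, N}). (\<Sum>i\<in>insert x I. l i * real_of_int (b i))\<^sup>2) =
     (\<Sum>b\<in>Pi\<^sub>E I (\<lambda>_. {-N, N}). 2 * (l x * real_of_int N)\<^sup>2 + 2 * (\<Sum>i\<in>I. l i * real_of_int (b i))\<^sup>2)"
    unfolding sum_PiE_signs_insert[OF insert(2) assms(2)] sum_fun_upd_insert[OF insert(1,2)]
    by (simp add: power2_eq_square algebra_simps)
  also have "\<dots> = 2 ^ card I * (2 * (l x * real_of_int N)\<^sup>2) + 2 * (2 ^ card I * (real_of_int N)\<^sup>2 * (\<Sum>i\<in>I. (l i)\<^sup>2))"
    unfolding sum.distrib sum_distrib_left [symmetric] insert.IH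
    using card_PiE_signs[OF insert(1) assms(2)] by simp
  finally show ?case using insert by (simp add: algebra_simps power_mult_distrib)
qed simp

text \<open>
  On sign vectors \<open>b\<^sub>i \<in> {-N, N}\<close> the quadratic part is twice \<open>c\<close> times the sum of the \<open>b\<^sub>i b\<^sub>j\<close>
  with \<open>i < j\<close>; subtracting the diagonal gives the polynomial mean zero.
\<close>
definition sign_quadratic :: "('a \<Rightarrow> real) \<Rightarrow> real \<Rightarrow> int \<Rightarrow> 'a set \<Rightarrow> ('a \<Rightarrow> int) \<Rightarrow> real" where
  "sign_quadratic l c N I b = (\<Sum>i\<in>I. l i * real_of_int (b i)) +
     c * ((\<Sum>i\<in>I. real_of_int (b i))\<^sup>2 - real (card I) * (real_of_int N)\<^sup>2)"

text \<open>The square of the sum grows by \<open>y^2 + 2 y s\<close>, with \<open>s\<close> the old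
  sum. The diagonal correction absorbs \<open>y^2 = N^2\<close>, so the new sign enters
  linearly.\<close>

lemma sign_quadratic_insert:
  assumes "finite I" "x \<notin> I" "y\<^sup>2 = N\<^sup>2"
  shows "sign_quadratic l c N (insert x I) (b(x := y)) =
    sign_quadratic l c N I b + real_of_int y * (l x + 2 * c * (\<Sum>i\<in>I. real_of_int (b i)))"
proof -
  have "(\<Sum>i\<in>insert x I. real_of_int ((b(x := y)) i)) = real_of_int y + (\<Sum>i\<in>I. real_of_int (b i))"
    using sum_fun_upd_insert[OF assms(1,2), of "\<lambda>_. 1"] by simp
  moreover have "(real_of_int y)\<^sup>2 = (real_of_int N)\<^sup>2" using assms(3) by (metis of_int_power)
  ultimately show ?thesis
    unfolding sign_quadratic_def sum_fun_upd_insert[OF assms(1,2)]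
    using assms(1,2) by (simp add: power2_sum algebra_simps)
qed

lemma sum_sign_quadratic:
  fixes N :: int
  assumes "finite I" "N \<noteq> 0"
  shows "(\<Sum>b\<in>Pi\<^sub>E I (\<lambda>_. {-N, N}). sign_quadratic l c N I b) = 0"
  using assms(1)
proof (induction I)
  case (insert x I)
  then show ?case
    by (subst sum_PiE_signs_insert[OF insert(2) assms(2)])
      (simp add: sign_quadratic_insert sum_distrib_left [symmetric])
qed (simp add: sign_quadratic_def)

text \<open>Adding the two values of a new sign \<open>y\<close> turns \<open>(w + y r)^2\<close>
  into \<open>2 w^2 + 2 y^2 r^2\<close>. Here \<open>r\<close> is affine in the old sum, so its
  first two moments suffice.\<close>

lemma sum_sign_quadratic_sq:
  fixes N :: int
  assumes "finite I" "N \<noteq> 0"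
  shows "(\<Sum>b\<in>Pi\<^sub>E I (\<lambda>_. {-N, N}). (sign_quadratic l c N I b)\<^sup>2) =
    2 ^ card I * ((real_of_int N)\<^sup>2 * (\<Sum>i\<in>I. (l i)\<^sup>2) + 2 * c\<^sup>2 * real (card I) * (real (card I) - 1) * real_of_int N ^ 4)"
  using assms(1)
proof (induction I)
  case (insert x I)
  let ?P = "Pi\<^sub>E I (\<lambda>_. {-N, N})"
  let ?s = "\<lambda>b. \<Sum>i\<in>I. real_of_int (b i)"
  have s1: "(\<Sum>b\<in>?P. ?s b) = 0"
    using sum_signs_linear[OF insert(1) assms(2), of "\<lambda>_. 1"] by simp
  have s2: "(\<Sum>b\<in>?P. (?s b)\<^sup>2) = 2 ^ card I * (real_of_int N)\<^sup>2 * card I"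
    using sum_signs_linear_sq[OF insert(1) assms(2), of "\<lambda>_. 1"] by simp
  have card: "(\<Sum>b\<in>?P. k) = 2 ^ card I * k" for k :: real
    using card_PiE_signs[OF insert(1) assms(2)] by simp
  have "(\<Sum>b\<in>Pi\<^sub>E (insert x I) (\<lambda>_. {-N, N}). (sign_quadratic l c N (insert x I) b)\<^sup>2) =
      (\<Sum>b\<in>?P. 2 * (sign_quadratic l c N I b)\<^sup>2 +
        (2 * (real_of_int N)\<^sup>2 * (l x)\<^sup>2 + 8 * (real_of_int N)\<^sup>2 * c * l x * ?s b + 8 * (real_of_int N)\<^sup>2 * c\<^sup>2 * (?s b)\<^sup>2))"
    unfolding sum_PiE_signs_insert[OF insert(2) assms(2)] using insert(1,2)
  proof (intro sum.cong refl)
    fix b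
    have "(w + y * r)\<^sup>2 + (w + - y * r)\<^sup>2 = 2 * w\<^sup>2 + 2 * y\<^sup>2 * r\<^sup>2" for w y r :: real
      by (simp add: power2_sum power2_diff power_mult_distrib)
    moreover have "2 * y\<^sup>2 * (u + 2 * c * s)\<^sup>2 = 2 * y\<^sup>2 * u\<^sup>2 + 8 * y\<^sup>2 * c * u * s + 8 * y\<^sup>2 * c\<^sup>2 * s\<^sup>2"
      for y u s :: real
      by (simp add: power2_sum power_mult_distrib algebra_simps)
    ultimately show "(sign_quadratic l c N (insert x I) (b(x := N)))\<^sup>2 + (sign_quadratic l c N (insert x I) (b(x := -N)))\<^sup>2 =
      2 * (sign_quadratic l c N I b)\<^sup>2 + (2 * (real_of_int N)\<^sup>2 * (l x)\<^sup>2 +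
        8 * (real_of_int N)\<^sup>2 * c * l x * ?s b + 8 * (real_of_int N)\<^sup>2 * c\<^sup>2 * (?s b)\<^sup>2)"
      by (simp only: sign_quadratic_insert[OF insert(1,2)] power2_minus of_int_minus)
  qed
  also have "\<dots> = 2 * (\<Sum>b\<in>?P. (sign_quadratic l c N I b)\<^sup>2) +
      (2 ^ card I * (2 * (real_of_int N)\<^sup>2 * (l x)\<^sup>2) + 8 * (real_of_int N)\<^sup>2 * c * l x * (\<Sum>b\<in>?P. ?s b)
        + 8 * (real_of_int N)\<^sup>2 * c\<^sup>2 * (\<Sum>b\<in>?P. (?s b)\<^sup>2))"
    by (simp only: sum.distrib sum_distrib_left card)
  also have "\<dots> = 2 ^ card (insert x I) * ((real_of_int N)\<^sup>2 * (\<Sum>i\<in>insert x I. (l i)\<^sup>2) +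
      2 * c\<^sup>2 * real (card (insert x I)) * (real (card (insert x I)) - 1) * real_of_int N ^ 4)"
  proof -
    have "2 * (E * (y\<^sup>2 * S + 2 * c\<^sup>2 * k * (k - 1) * y ^ 4)) + (E * (2 * y\<^sup>2 * u\<^sup>2) + 8 * y\<^sup>2 * c * u * 0 + 8 * y\<^sup>2 * c\<^sup>2 * (E * y\<^sup>2 * k)) =
      2 * E * (y\<^sup>2 * (u\<^sup>2 + S) + 2 * c\<^sup>2 * (k + 1) * k * y ^ 4)" for E y S k u :: real
      by (simp add: power2_eq_square power3_eq_cube power4_eq_xxxx algebra_simps)
    then show ?thesis
      unfolding s1 s2 insert.IH using insert(1,2) by simp
  qed
  finally show ?case .
qed (simp add: sign_quadratic_def)

text \<open>Outside the interval, \<open>(f x)^2 - M\<close> has the factors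
  \<open>f x - sqrt M\<close>, larger than \<open>t\<close> in absolute value, and
  \<open>f x + sqrt M\<close>, at least \<open>sqrt M\<close>. Each exceptional point thus adds at
  least \<open>M t^2\<close> to the sum of squares.\<close>

lemma chebyshev_sqrt:
  fixes f :: "'a \<Rightarrow> real"
  assumes "finite V" "V \<noteq> {}" "0 < t" "0 < M" "\<And>x. x \<in> V \<Longrightarrow> 0 \<le> f x"
    and var: "(\<Sum>x\<in>V. ((f x)\<^sup>2 - M)\<^sup>2) \<le> real (card V) * (v * M * t\<^sup>2)"
  shows "card {x \<in> V. f x \<in> {sqrt M - t .. sqrt M + t}} / card V \<ge> 1 - v"
proof -
  define G where "G = {x \<in> V. f x \<in> {sqrt M - t .. sqrt M + t}}"
  have G: "G \<subseteq> V" "finite G" using assms(1) by (auto simp: G_def)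
  have "M * t\<^sup>2 \<le> ((f x)\<^sup>2 - M)\<^sup>2" if x: "x \<in> V - G" for x
  proof -
    have M: "sqrt M > 0" using \<open>0 < M\<close> by simp
    have f: "0 \<le> f x" using x assms(5) by blast
    have "\<not> \<bar>f x - sqrt M\<bar> \<le> t" using x by (simp add: G_def abs_le_iff) linarith
    then have "t \<le> \<bar>f x - sqrt M\<bar>" by simp
    moreover have "sqrt M \<le> \<bar>f x + sqrt M\<bar>" using M f by linarith
    ultimately have "t * sqrt M \<le> \<bar>f x - sqrt M\<bar> * \<bar>f x + sqrt M\<bar>"
      using M by (intro mult_mono) simp_all
    also have "\<dots> = \<bar>(f x)\<^sup>2 - (sqrt M)\<^sup>2\<bar>"
      by (simp only: abs_mult [symmetric] square_diff_square_factored power2_eq_square mult.commute)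
    also have "(sqrt M)\<^sup>2 = M" using \<open>0 < M\<close> by simp
    finally have "(t * sqrt M)\<^sup>2 \<le> \<bar>(f x)\<^sup>2 - M\<bar>\<^sup>2"
      using M \<open>0 < t\<close> by (intro power_mono) simp_all
    then show ?thesis using \<open>0 < M\<close> by (simp add: power_mult_distrib mult.commute)
  qed
  then have "(\<Sum>x\<in>V - G. M * t\<^sup>2) \<le> (\<Sum>x\<in>V - G. ((f x)\<^sup>2 - M)\<^sup>2)" by (intro sum_mono)
  also have "\<dots> \<le> (\<Sum>x\<in>V. ((f x)\<^sup>2 - M)\<^sup>2)"
    using assms(1) by (intro sum_mono2) auto
  also note var
  finally have "real (card (V - G)) * (M * t\<^sup>2) \<le> (real (card V) * v) * (M * t\<^sup>2)"
    by (simp only: sum_constant mult.assoc)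
  then have "real (card (V - G)) \<le> real (card V) * v"
    by (rule mult_right_le_imp_le) (use \<open>0 < M\<close> \<open>0 < t\<close> in simp)
  moreover have "card (V - G) = card V - card G" using G by (intro card_Diff_subset)
  moreover have "card G \<le> card V" using assms(1) G(1) by (rule card_mono)
  ultimately have "real (card V) * (1 - v) \<le> real (card G)"
    by (simp add: of_nat_diff right_diff_distrib)
  moreover have "real (card V) > 0" using assms(1,2) by (simp add: card_gt_0_iff)
  ultimately show ?thesis unfolding G_def [symmetric] by (simp add: pos_le_divide_eq mult.commute)
qed

subsection \<open>Concentration of the distance\<close>

text \<open>Cauchy-Schwarz against the constant vector, read off from the nonnegative sum of the
  squares \<open>(k a_i - A)^2\<close>.\<close>

lemma square_sum_le:
  fixes a :: "'a \<Rightarrow> real"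
  assumes "finite I"
  shows "(\<Sum>i\<in>I. a i)\<^sup>2 \<le> card I * (\<Sum>i\<in>I. (a i)\<^sup>2)"
proof (cases "I = {}")
  case False
  define k A S where "k = real (card I)" and "A = (\<Sum>i\<in>I. a i)" and "S = (\<Sum>i\<in>I. (a i)\<^sup>2)"
  have "0 \<le> (\<Sum>i\<in>I. (k * a i - A)\<^sup>2)" by (intro sum_nonneg) simp
  also have "\<dots> = (\<Sum>i\<in>I. k\<^sup>2 * (a i)\<^sup>2 - 2 * k * A * a i + A\<^sup>2)"
    by (intro sum.cong) (simp_all add: power2_diff power_mult_distrib mult_ac)
  also have "\<dots> = k\<^sup>2 * S - 2 * k * A * A + k * A\<^sup>2"
    by (simp add: sum.distrib sum_subtractf sum_distrib_left [symmetric] k_def A_def S_def)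
  also have "\<dots> = k * (k * S - A\<^sup>2)" by (simp add: power2_eq_square algebra_simps)
  finally have "0 \<le> k * (k * S - A\<^sup>2)" .
  moreover have "k > 0" using False assms by (simp add: k_def card_gt_0_iff)
  ultimately show ?thesis by (simp add: zero_le_mult_iff k_def A_def S_def)
qed simp

lemma mean_arith:
  fixes P :: real assumes "P \<ge> 3" shows "P\<^sup>2 / 2 \<le> P\<^sup>2 - (P + 1)"
proof -
  have "P * 3 \<le> P * P" using assms by (intro mult_left_mono) auto
  with assms show ?thesis unfolding power2_eq_square by linarith
qed

text \<open>Bounds the variance in the worst case over \<open>\<alpha>\<close>, with
  \<open>y\<close> in the role of \<open>N\<close> and \<open>Q\<close> the denominator of the
  squared distance.\<close>

lemma variance_arith:
  fixes P y n Q :: real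
  assumes "P \<ge> 3" "y > 0" "n = P - 1" "Q = 4 * y\<^sup>2 * P\<^sup>2 * n"
  shows "y\<^sup>2 * (4 * P ^ 4 * (n * y\<^sup>2) / Q\<^sup>2) + 2 * ((P + 1)\<^sup>2 / Q\<^sup>2) * n * n * y ^ 4 \<le> 1 / (2 * P)"
proof -
  \<comment> \<open>The inequality needed is \<open>2 P^4 - 5 P^3 - P^2 + P + 1 \<ge> 0\<close>,
    split as \<open>P^2 (P (2 P - 5) - 1) + (P + 1)\<close>.\<close>
  have "P\<^sup>2 * 1 \<le> P\<^sup>2 * (P * (2 * P - 5))"
    using assms by (intro mult_left_mono) (auto intro: order_trans[OF _ mult_mono[of 3 P 1]])
  then have "0 \<le> P\<^sup>2 * (P * (2 * P - 5)) - P\<^sup>2" by simp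
  then have "0 \<le> 2 * ((P\<^sup>2 * (P * (2 * P - 5)) - P\<^sup>2) + (P + 1))"
    using assms(1) by (intro mult_nonneg_nonneg add_nonneg_nonneg) auto
  also have "\<dots> = 8 * P ^ 3 * n - (4 * P ^ 4 + 2 * (P + 1)\<^sup>2 * n)"
    unfolding assms(3) by (simp add: power2_eq_square power3_eq_cube power4_eq_xxxx algebra_simps)
  finally have *: "4 * P ^ 4 + 2 * (P + 1)\<^sup>2 * n \<le> 8 * P ^ 3 * n" by simp
  have Q: "Q\<^sup>2 = (y ^ 4 * n) * (8 * P ^ 3 * n) * (2 * P)" unfolding assms(4) by (simp add: power2_eq_square power3_eq_cube power4_eq_xxxx algebra_simps)
  have "y\<^sup>2 * (4 * P ^ 4 * (n * y\<^sup>2) / Q\<^sup>2) + 2 * ((P + 1)\<^sup>2 / Q\<^sup>2) * n * n * y ^ 4 =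
      (y\<^sup>2 * (4 * P ^ 4 * (n * y\<^sup>2)) + 2 * (P + 1)\<^sup>2 * n * n * y ^ 4) / Q\<^sup>2"
    by (simp add: add_divide_distrib)
  also have "y\<^sup>2 * (4 * P ^ 4 * (n * y\<^sup>2)) + 2 * (P + 1)\<^sup>2 * n * n * y ^ 4 = (y ^ 4 * n) * (4 * P ^ 4 + 2 * (P + 1)\<^sup>2 * n)"
    by (simp add: power2_eq_square power3_eq_cube power4_eq_xxxx algebra_simps)
  also have "\<dots> / Q\<^sup>2 \<le> (y ^ 4 * n) * (8 * P ^ 3 * n) / Q\<^sup>2"
    using * assms by (intro divide_right_mono mult_left_mono) auto
  also have "\<dots> = 1 / (2 * P)" unfolding Q
    using assms by (intro nonzero_divide_mult_cancel_left) auto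
  finally show ?thesis .
qed

theorem theorem5:
  fixes \<eta> :: real and N :: int and p :: nat and \<alpha> :: complex
  assumes "0 < \<eta>" and "\<eta> < 1 / 2"
    and "N \<ge> 1"
    and "prime p" and "odd p"
    and "\<alpha> \<in> cyc_box p N"
  shows "1 / real (card (cyc_vertices p N)) *
           real (card {x \<in> cyc_vertices p N.
             cyc_dist p N \<alpha> x \<in>
               {sqrt (mean_sq_dist p N \<alpha> (cyc_vertices p N)) - real p powr (- \<eta>) ..
                sqrt (mean_sq_dist p N \<alpha> (cyc_vertices p N)) + real p powr (- \<eta>)}})
         \<ge> 1 - 22 / real p powr (1 - 2 * \<eta>)"
proof -
  interpret prime_cyclotomic p by standard fact
  have p3: "p \<ge> 3" using p_gt_1 \<open>odd p\<close> by (cases "p = 2") auto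
  define P n N' where "P = real p" and "n = real (p - 1)" and "N' = real_of_int N"
  have P3: "P \<ge> 3" and n: "n = P - 1" and N': "N' \<ge> 1"
    using p3 \<open>N \<ge> 1\<close> by (auto simp: P_def n_def N'_def of_nat_diff)
  define I where "I = {1..p-1}"
  have I: "finite I" "real (card I) = n" and cardI: "card I = p - 1" by (simp_all add: I_def n_def)
  obtain a where a: "\<And>j. j \<in> I \<Longrightarrow> a j \<in> {-N..N}" "\<alpha> = lincomb a"
    using assms(6) unfolding cyc_box_def lincomb_def I_def by blast
  define A S where "A = (\<Sum>j\<in>I. real_of_int (a j))" and "S = (\<Sum>j\<in>I. (real_of_int (a j))\<^sup>2)"
  have AS: "A\<^sup>2 \<le> n * S"
    using square_sum_le[OF I(1), of "\<lambda>j. real_of_int (a j)"] by (simp add: A_def S_def I)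
  have "S \<le> (\<Sum>j\<in>I. N'\<^sup>2)"
    unfolding S_def
  proof (rule sum_mono)
    fix j assume "j \<in> I"
    then have "\<bar>real_of_int (a j)\<bar> \<le> \<bar>N'\<bar>" using a(1)[of j] by (auto simp: N'_def)
    then show "(real_of_int (a j))\<^sup>2 \<le> N'\<^sup>2" by (simp add: abs_le_square_iff)
  qed
  then have SN: "S \<le> n * N'\<^sup>2" by (simp add: I)
  define Q where "Q = 4 * N'\<^sup>2 * P\<^sup>2 * n"
  have Q: "Q > 0" using P3 N' by (simp add: Q_def n)
  \<comment> \<open>\<open>m\<close>, \<open>l\<close> and \<open>c\<close> come from expanding the
    numerator of the squared distance in the signs. The \<open>n * N'^2\<close> next to
    \<open>A^2\<close> is the mean of the squared sum of the signs.\<close>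
  define m where "m = (P\<^sup>2 * (n * N'\<^sup>2 + S) - (P + 1) * (n * N'\<^sup>2 + A\<^sup>2)) / Q"
  define l where "l = (\<lambda>j. (2 * (P + 1) * A - 2 * P\<^sup>2 * real_of_int (a j)) / Q)"
  define c where "c = - (P + 1) / Q"
  have c2: "c\<^sup>2 = (P + 1)\<^sup>2 / Q\<^sup>2" by (simp only: c_def power_divide power2_minus)
  define B where "B = Pi\<^sub>E I (\<lambda>_. {-N, N})"
  have cardB: "card B = 2 ^ (p - 1)"
    unfolding B_def using \<open>N \<ge> 1\<close> I cardI card_PiE_signs[of I N] by simp

  \<comment> \<open>The squared distance as a quadratic polynomial in signs\<close>
  have dist: "(cyc_dist p N \<alpha> (lincomb b))\<^sup>2 = m + sign_quadratic l c N I b" if "b \<in> B" for b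
  proof -
    define T where "T = (\<Sum>j\<in>I. real_of_int (b j))"
    define U where "U = (\<Sum>j\<in>I. real_of_int (a j) * real_of_int (b j))"
    have "(\<Sum>j\<in>I. (real_of_int (b j))\<^sup>2) = (\<Sum>j\<in>I. N'\<^sup>2)"
      using that by (intro sum.cong) (auto simp: B_def PiE_iff N'_def)
    then have "(\<Sum>j\<in>I. (real_of_int (b j) - real_of_int (a j))\<^sup>2) = n * N'\<^sup>2 + S - 2 * U"
      by (simp add: power2_diff sum.distrib sum_subtractf S_def U_def I sum_distrib_left mult_ac)
    then have 1: "(cyc_dist p N \<alpha> (lincomb b))\<^sup>2 = (P\<^sup>2 * (n * N'\<^sup>2 + S - 2 * U) - (P + 1) * (T - A)\<^sup>2) / Q"
      by (simp only: a(2) cyc_dist_lincomb_sq Q_def I_def [symmetric] P_def [symmetric] n_def [symmetric]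
          N'_def [symmetric] T_def [symmetric] A_def [symmetric])
    have "(\<Sum>j\<in>I. l j * real_of_int (b j)) =
        (\<Sum>j\<in>I. (2 * (P + 1) * A) / Q * real_of_int (b j) - 2 * P\<^sup>2 / Q * (real_of_int (a j) * real_of_int (b j)))"
      by (intro sum.cong) (simp_all add: l_def diff_divide_distrib left_diff_distrib)
    also have "\<dots> = (2 * (P + 1) * A) / Q * T - 2 * P\<^sup>2 / Q * U"
      by (simp only: sum_subtractf sum_distrib_left [symmetric] T_def U_def)
    finally have "sign_quadratic l c N I b =
        (2 * (P + 1) * A * T - 2 * P\<^sup>2 * U - (P + 1) * (T\<^sup>2 - n * N'\<^sup>2)) / Q"
      by (simp add: sign_quadratic_def T_def [symmetric] I N'_def [symmetric] c_def diff_divide_distrib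
          minus_divide_left [symmetric] del: minus_add_distrib)
    then have "m + sign_quadratic l c N I b = (P\<^sup>2 * (n * N'\<^sup>2 + S) - (P + 1) * (n * N'\<^sup>2 + A\<^sup>2) +
        (2 * (P + 1) * A * T - 2 * P\<^sup>2 * U - (P + 1) * (T\<^sup>2 - n * N'\<^sup>2))) / Q"
      by (simp only: m_def add_divide_distrib)
    also have "P\<^sup>2 * (n * N'\<^sup>2 + S) - (P + 1) * (n * N'\<^sup>2 + A\<^sup>2) +
        (2 * (P + 1) * A * T - 2 * P\<^sup>2 * U - (P + 1) * (T\<^sup>2 - n * N'\<^sup>2)) =
        P\<^sup>2 * (n * N'\<^sup>2 + S - 2 * U) - (P + 1) * (T - A)\<^sup>2"
      by (simp add: power2_eq_square algebra_simps)
    finally show ?thesis using 1 by simp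
  qed

  \<comment> \<open>Mean and variance over the vertices\<close>
  define V where "V = cyc_vertices p N"
  have V: "V = lincomb ` B" by (simp add: V_def cyc_vertices_eq B_def I_def)
  have inj: "inj_on lincomb B" unfolding B_def I_def by (rule inj_on_lincomb)
  have cardV: "card V = card B" unfolding V using inj by (rule card_image)
  then have V0: "finite V" "V \<noteq> {}" using cardB card_gt_0_iff[of V] by auto
  have "(\<Sum>x\<in>V. (cyc_dist p N \<alpha> x)\<^sup>2) = (\<Sum>b\<in>B. m + sign_quadratic l c N I b)"
    unfolding V by (simp add: sum.reindex[OF inj] dist)
  also have "\<dots> = real (card B) * m"
    using sum_sign_quadratic[of I N l c] I \<open>N \<ge> 1\<close> by (simp add: sum.distrib B_def)
  finally have mean: "mean_sq_dist p N \<alpha> V = m"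
    by (simp add: mean_sq_dist_def cardV cardB)
  have "(\<Sum>x\<in>V. ((cyc_dist p N \<alpha> x)\<^sup>2 - m)\<^sup>2) = (\<Sum>b\<in>B. (sign_quadratic l c N I b)\<^sup>2)"
    unfolding V by (simp add: sum.reindex[OF inj] dist)
  also have "\<dots> = real (card V) * (N'\<^sup>2 * (\<Sum>i\<in>I. (l i)\<^sup>2) + 2 * c\<^sup>2 * n * (n - 1) * N' ^ 4)"
    unfolding B_def using sum_sign_quadratic_sq[of I N l c] I cardI \<open>N \<ge> 1\<close> cardB cardV by (simp add: N'_def)
  finally have var: "(\<Sum>x\<in>V. ((cyc_dist p N \<alpha> x)\<^sup>2 - m)\<^sup>2) = \<dots>" .

  \<comment> \<open>Upper bound for the variance\<close>
  have "(2 * (P + 1) * A - 2 * P\<^sup>2 * x)\<^sup>2 =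
      4 * (P + 1)\<^sup>2 * A\<^sup>2 + 4 * P ^ 4 * x\<^sup>2 - 8 * (P + 1) * P\<^sup>2 * A * x" for x
    by (simp add: power2_eq_square power4_eq_xxxx algebra_simps)
  then have "(\<Sum>i\<in>I. (l i)\<^sup>2) = (\<Sum>i\<in>I. (4 * (P + 1)\<^sup>2 * A\<^sup>2 + 4 * P ^ 4 * (real_of_int (a i))\<^sup>2 - 8 * (P + 1) * P\<^sup>2 * A * real_of_int (a i)) / Q\<^sup>2)"
    by (simp only: l_def power_divide)
  also have "\<dots> = (4 * (P + 1)\<^sup>2 * (n * A\<^sup>2) + 4 * P ^ 4 * S - 8 * (P + 1) * P\<^sup>2 * A * A) / Q\<^sup>2"
    by (simp only: sum_divide_distrib [symmetric] sum.distrib sum_subtractf sum_distrib_left [symmetric] A_def S_def sum_constant I)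
  also have "4 * (P + 1)\<^sup>2 * (n * A\<^sup>2) + 4 * P ^ 4 * S - 8 * (P + 1) * P\<^sup>2 * A * A =
      4 * P ^ 4 * S - 4 * (P + 1) * (P\<^sup>2 + 1) * A\<^sup>2"
    by (simp add: n power2_eq_square algebra_simps)
  also have "\<dots> \<le> 4 * P ^ 4 * S" using P3 by simp
  also have "\<dots> \<le> 4 * P ^ 4 * (n * N'\<^sup>2)" using SN by (intro mult_left_mono) auto
  finally have l: "(\<Sum>i\<in>I. (l i)\<^sup>2) \<le> 4 * P ^ 4 * (n * N'\<^sup>2) / Q\<^sup>2" using Q by (simp add: divide_right_mono)
  have "N'\<^sup>2 * (\<Sum>i\<in>I. (l i)\<^sup>2) + 2 * c\<^sup>2 * n * (n - 1) * N' ^ 4 \<le>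
      N'\<^sup>2 * (4 * P ^ 4 * (n * N'\<^sup>2) / Q\<^sup>2) + 2 * c\<^sup>2 * n * n * N' ^ 4"
    using l P3 n by (intro add_mono mult_left_mono mult_right_mono) auto
  also have "\<dots> \<le> 1 / (2 * P)"
    unfolding c2 using N' by (intro variance_arith[OF P3 _ n Q_def]) simp
  finally have v: "N'\<^sup>2 * (\<Sum>i\<in>I. (l i)\<^sup>2) + 2 * c\<^sup>2 * n * (n - 1) * N' ^ 4 \<le> 1 / (2 * P)" .

  \<comment> \<open>Lower bound for the mean\<close>
  have m: "m \<ge> 1 / 8"
  proof -
    \<comment> \<open>Since \<open>A^2 \<le> n S\<close> and \<open>(P + 1) n = P^2 - 1\<close>, the
      part of the numerator that depends on \<open>\<alpha>\<close> is nonnegative. The remaining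
      part is at least \<open>n N'^2 P^2 / 2 = Q / 8\<close>.\<close>
    have "(P + 1) * A\<^sup>2 \<le> (P + 1) * (n * S)" using AS P3 by (intro mult_left_mono) auto
    also have "\<dots> = P\<^sup>2 * S - S" by (simp add: n power2_eq_square algebra_simps)
    also have "\<dots> \<le> P\<^sup>2 * S" by (simp add: S_def sum_nonneg)
    finally have 1: "(P + 1) * A\<^sup>2 \<le> P\<^sup>2 * S" .
    have "(n * N'\<^sup>2) * (P\<^sup>2 / 2) \<le> (n * N'\<^sup>2) * (P\<^sup>2 - (P + 1))"
      using P3 n mean_arith[OF P3] by (intro mult_left_mono) auto
    with 1 have "Q / 8 \<le> P\<^sup>2 * (n * N'\<^sup>2 + S) - (P + 1) * (n * N'\<^sup>2 + A\<^sup>2)"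
      by (simp add: Q_def algebra_simps)
    then show ?thesis using Q by (simp add: m_def field_simps)
  qed

  \<comment> \<open>Chebyshev's inequality for the distance\<close>
  define t where "t = real p powr (- \<eta>)"
  have t: "t > 0" and t2: "t\<^sup>2 = P powr (- 2 * \<eta>)"
    using p3 by (auto simp: t_def P_def power2_eq_square powr_add [symmetric])
  let ?v = "22 / P powr (1 - 2 * \<eta>)"
  \<comment> \<open>The powers of \<open>P\<close> cancel: \<open>?v * t^2 = 22 / P\<close>, and the
    factor \<open>1 / 8\<close> is the lower bound for \<open>m\<close>.\<close>
  have "1 / (2 * P) \<le> 22 / 8 / P" using P3 by (simp add: field_simps)
  also have "\<dots> = ?v * (1 / 8) * t\<^sup>2"
    using P3 by (simp add: t2 powr_diff powr_minus field_simps)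
  also have "\<dots> \<le> ?v * m * t\<^sup>2" using m by (intro mult_right_mono mult_left_mono) auto
  finally have "N'\<^sup>2 * (\<Sum>i\<in>I. (l i)\<^sup>2) + 2 * c\<^sup>2 * n * (n - 1) * N' ^ 4 \<le> ?v * m * t\<^sup>2" using v by simp
  then have "(\<Sum>x\<in>V. ((cyc_dist p N \<alpha> x)\<^sup>2 - m)\<^sup>2) \<le> real (card V) * (?v * m * t\<^sup>2)"
    unfolding var by (intro mult_left_mono) auto
  moreover have "0 \<le> cyc_dist p N \<alpha> x" if "x \<in> V" for x
    using that \<open>N \<ge> 1\<close> by (auto simp: V a(2) cyc_dist_lincomb_nonneg)
  ultimately have "1 - ?v \<le> card {x \<in> V. cyc_dist p N \<alpha> x \<in> {sqrt m - t .. sqrt m + t}} / card V"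
    using V0 t m by (intro chebyshev_sqrt) auto
  then show ?thesis
    unfolding V_def [symmetric] mean t_def [symmetric] by (simp add: P_def)
qed

end
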